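(* (1) For each $n\ge4$, $\mathbf K_{0,2}\le\mathbf K_{1,2}$ and $\mathbf K_{1,2}$ is isomorphic to a subalgebra of $\mathbf K_n^\emptyset$. (2) For $4\le m<n$ and every up-set $U$ of $X_m$, $\mathbf K_m^U$ is isomorphic to a subalgebra of $\mathbf K_n^{\tilde U}$, where $\tilde U$ is the up-set of $X_n$ generated by: each $(a_i,a_j)$ with $(a_i,a_j)\in U$ and $i,j<m-1$; each $(a_{n-1},a_j)$ such that $(a_{m-1},a_j)\in U$ and $j<m-1$; and $(a_{n-1},a_{n-1})$ if $(a_{m-1},a_{m-1})\in U$ (here the embedding is induced by $\mathbf{DP}_m\le\mathbf{DP}_n$ sending $a_1\mapsto a_1$, $a_k\mapsto a_k$ for $2\le k\le m-2$, $0\mapsto0$, $1\mapsto 1$).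
   Context: For a bounded commutative residuated lattice $\mathbf A$ (lattice, commutative monoid $(A,\cdot,1)$ with $ab\le c$ iff $a\le b\to c$, $1$ greatest, $0$ least), $K(\mathbf A)$ is the algebra on $A\times A$ with $(a,b)\vee(c,d)=(a\vee c,b\wedge d)$, $(a,b)\wedge(c,d)=(a\wedge c,b\vee d)$, $(a,b)(c,d)=(ac,(a\to d)\wedge(c\to b))$, $(a,b)\to(c,d)=((a\to c)\wedge(d\to b),ad)$, unit $(1,1)$, constant $0$ as $(0,1)$. The drastic product chain $\mathbf{DP}_n$ has universe $\{0=a_{n-1}<a_{n-2}<\dots<a_1<1\}$, product $xy=0$ if $x,y\ne1$ and $xy=x\wedge y$ otherwise, implication $x\to y=1$ if $x\le y$, $=a_1$ if $1>x>y$, $1\to y=y$. Note $\mathbf{DP}_3$ is the chain $\mathbf{Ł}_2=\{0,a_1,1\}$. Let $K_n^\emptyset=\{(x,1),(1,x),(x,a_1),(a_1,x):x\in DP_n\}$; $X_n=\{(a_i,a_j):i\ge j>1\}$ ordered coordinatewise; for an up-set $U$ of $X_n$, $K_n^U=K_n^\emptyset\cup\{(x,y):(x,y)\in U\text{ or }(y,x)\in U\}$, a subalgebra $\mathbf K_n^U$ of $K(\mathbf{DP}_n)$. With $u\oplus v=\min(1,u+v)$ on $\mathbf{Ł}_2=\{0,1/2,1\}$ (product $\max(0,x+y-1)$), $\mathbf K_{0,2}$ and $\mathbf K_{1,2}$ are the subalgebras of $K(\mathbf{Ł}_2)$ with universes $\{(u,v):u\oplus v=1\}$ and $\{(u,v):u\oplus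 v\ge 1/2\}$ respectively. *)

theory Defs
  imports "HOL-Algebra.Group" "HOL-Library.Product_Order" Complex_Main
begin

record 'a rlat = "'a monoid" +
  Join :: "'a \<Rightarrow> 'a \<Rightarrow> 'a"
  Meet :: "'a \<Rightarrow> 'a \<Rightarrow> 'a"
  Imp :: "'a \<Rightarrow> 'a \<Rightarrow> 'a"
  Zero :: "'a"

text \<open>Record operations are total on the underlying type, so closure of the carrier has to be
  demanded explicitly; \<open>rl_algebra\<close>, which the notions below build on, does this.\<close>

definition rl_algebra :: "'a rlat \<Rightarrow> bool" where
  "rl_algebra A \<longleftrightarrow>
     \<one>\<^bsub>A\<^esub> \<in> carrier A \<and> Zero A \<in> carrier A \<and>
     (\<forall>x\<in>carrier A. \<forall>y\<in>carrier A.
        Join A x y \<in> carrier A \<and> Meet A x y \<in> carrier A \<and>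
        x \<otimes>\<^bsub>A\<^esub> y \<in> carrier A \<and> Imp A x y \<in> carrier A)"

definition rl_subalgebra :: "'a rlat \<Rightarrow> 'a rlat \<Rightarrow> bool" where
  "rl_subalgebra B A \<longleftrightarrow>
     rl_algebra B \<and> rl_algebra A \<and> carrier B \<subseteq> carrier A \<and>
     \<one>\<^bsub>B\<^esub> = \<one>\<^bsub>A\<^esub> \<and> Zero B = Zero A \<and>
     (\<forall>x\<in>carrier B. \<forall>y\<in>carrier B.
        Join B x y = Join A x y \<and> Meet B x y = Meet A x y \<and>
        x \<otimes>\<^bsub>B\<^esub> y = x \<otimes>\<^bsub>A\<^esub> y \<and> Imp B x y = Imp A x y)"

definition rl_iso :: "('a \<Rightarrow> 'b) \<Rightarrow> 'a rlat \<Rightarrow> 'b rlat \<Rightarrow> bool" where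
  "rl_iso h A B \<longleftrightarrow>
     rl_algebra A \<and> rl_algebra B \<and> bij_betw h (carrier A) (carrier B) \<and>
     h \<one>\<^bsub>A\<^esub> = \<one>\<^bsub>B\<^esub> \<and> h (Zero A) = Zero B \<and>
     (\<forall>x\<in>carrier A. \<forall>y\<in>carrier A.
        h (Join A x y) = Join B (h x) (h y) \<and> h (Meet A x y) = Meet B (h x) (h y) \<and>
        h (x \<otimes>\<^bsub>A\<^esub> y) = h x \<otimes>\<^bsub>B\<^esub> h y \<and> h (Imp A x y) = Imp B (h x) (h y))"

definition iso_to_subalgebra :: "'a rlat \<Rightarrow> 'b rlat \<Rightarrow> bool" where
  "iso_to_subalgebra A B \<longleftrightarrow> (\<exists>C h. rl_subalgebra C B \<and> rl_iso h A C)"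

definition rl_embedding :: "('a \<Rightarrow> 'b) \<Rightarrow> 'a rlat \<Rightarrow> 'b rlat \<Rightarrow> bool" where
  "rl_embedding h A B \<longleftrightarrow>
     (let C = B\<lparr>carrier := h ` carrier A\<rparr> in rl_subalgebra C B \<and> rl_iso h A C)"

text \<open>The lattice order \<open>x \<le> y\<close> is expressed as \<open>Meet A x y = x\<close>.\<close>

locale bounded_comm_residuated_lattice = comm_monoid A
  for A :: "'a rlat" (structure) +
  assumes algebra: "rl_algebra A"
    and join_comm: "\<lbrakk>x \<in> carrier A; y \<in> carrier A\<rbrakk> \<Longrightarrow> Join A x y = Join A y x"
    and meet_comm: "\<lbrakk>x \<in> carrier A; y \<in> carrier A\<rbrakk> \<Longrightarrow> Meet A x y = Meet A y x"
    and join_assoc: "\<lbrakk>x \<in> carrier A; y \<in> carrier A; z \<in> carrier A\<rbrakk>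
        \<Longrightarrow> Join A (Join A x y) z = Join A x (Join A y z)"
    and meet_assoc: "\<lbrakk>x \<in> carrier A; y \<in> carrier A; z \<in> carrier A\<rbrakk>
        \<Longrightarrow> Meet A (Meet A x y) z = Meet A x (Meet A y z)"
    and join_absorb: "\<lbrakk>x \<in> carrier A; y \<in> carrier A\<rbrakk> \<Longrightarrow> Join A x (Meet A x y) = x"
    and meet_absorb: "\<lbrakk>x \<in> carrier A; y \<in> carrier A\<rbrakk> \<Longrightarrow> Meet A x (Join A x y) = x"
    and residuation: "\<lbrakk>x \<in> carrier A; y \<in> carrier A; z \<in> carrier A\<rbrakk>
        \<Longrightarrow> Meet A (x \<otimes> y) z = x \<otimes> y \<longleftrightarrow> Meet A x (Imp A y z) = x"
    and one_greatest: "x \<in> carrier A \<Longrightarrow> Meet A x \<one> = x"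
    and zero_least: "x \<in> carrier A \<Longrightarrow> Meet A (Zero A) x = Zero A"

definition K :: "'a rlat \<Rightarrow> ('a \<times> 'a) rlat" where
  "K A = \<lparr>carrier = carrier A \<times> carrier A,
     mult = (\<lambda>(a, b) (c, d). (a \<otimes>\<^bsub>A\<^esub> c, Meet A (Imp A a d) (Imp A c b))),
     one = (\<one>\<^bsub>A\<^esub>, \<one>\<^bsub>A\<^esub>),
     Join = (\<lambda>(a, b) (c, d). (Join A a c, Meet A b d)),
     Meet = (\<lambda>(a, b) (c, d). (Meet A a c, Join A b d)),
     Imp = (\<lambda>(a, b) (c, d). (Meet A (Imp A a c) (Imp A d b), a \<otimes>\<^bsub>A\<^esub> d)),
     Zero = (Zero A, \<one>\<^bsub>A\<^esub>)\<rparr>"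

text \<open>\<open>\<a> i\<close> is the element $a_i$, with $a_0 = 1$; larger indices are smaller elements.
  The least element of the $n$-element chain is \<open>\<a> (n - 1)\<close>.\<close>

datatype dp = \<a> (idx: nat)

instantiation dp :: linorder
begin
definition less_eq_dp :: "dp \<Rightarrow> dp \<Rightarrow> bool" where "x \<le> y \<longleftrightarrow> idx y \<le> idx x"
definition less_dp :: "dp \<Rightarrow> dp \<Rightarrow> bool" where "x < y \<longleftrightarrow> idx y < idx x"
instance
  by standard (auto simp: less_eq_dp_def less_dp_def dp.expand)
end

definition DP :: "nat \<Rightarrow> dp rlat" where
  "DP n = \<lparr>carrier = \<a> ` {..<n},
     mult = (\<lambda>x y. if x \<noteq> \<a> 0 \<and> y \<noteq> \<a> 0 then \<a> (n - 1) else min x y),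
     one = \<a> 0,
     Join = max, Meet = min,
     Imp = (\<lambda>x y. if x \<le> y then \<a> 0 else if x = \<a> 0 then y else \<a> 1),
     Zero = \<a> (n - 1)\<rparr>"

lemma DP_residuated:
  assumes "n \<ge> 2"
  shows "bounded_comm_residuated_lattice (DP n)"
  using assms
  apply unfold_locales
                   apply (auto simp: DP_def rl_algebra_def min_def max_def less_eq_dp_def Units_def
      split: if_splits)
  done

definition X :: "nat \<Rightarrow> (dp \<times> dp) set" where
  "X n = {(\<a> i, \<a> j) | i j. i < n \<and> i \<ge> j \<and> j > 1}"

text \<open>The order on pairs is the coordinatewise one of \<open>HOL-Library.Product_Order\<close>.\<close>

definition up_set :: "nat \<Rightarrow> (dp \<times> dp) set \<Rightarrow> bool" where
  "up_set n U \<longleftrightarrow> U \<subseteq> X n \<and> (\<forall>p\<in>U. \<forall>q\<in>X n. p \<le> q \<longrightarrow> q \<in> U)"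

definition up_closure :: "nat \<Rightarrow> (dp \<times> dp) set \<Rightarrow> (dp \<times> dp) set" where
  "up_closure n G = {q \<in> X n. \<exists>p\<in>G. p \<le> q}"

lemma up_closure_least:
  assumes "G \<subseteq> X n"
  shows "up_set n (up_closure n G)" "G \<subseteq> up_closure n G"
    "\<lbrakk>up_set n V; G \<subseteq> V\<rbrakk> \<Longrightarrow> up_closure n G \<subseteq> V"
  using assms by (auto simp: up_set_def up_closure_def intro: order_trans)

definition K_univ :: "nat \<Rightarrow> (dp \<times> dp) set \<Rightarrow> (dp \<times> dp) set" where
  "K_univ n U =
     (\<Union>x\<in>carrier (DP n). {(x, \<a> 0), (\<a> 0, x), (x, \<a> 1), (\<a> 1, x)}) \<union>
     {(x, y). (x, y) \<in> U \<or> (y, x) \<in> U}"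

text \<open>The algebra $K_n^\emptyset$ is \<open>K_DP n {}\<close>.\<close>

definition K_DP :: "nat \<Rightarrow> (dp \<times> dp) set \<Rightarrow> (dp \<times> dp) rlat" where
  "K_DP n U = (K (DP n))\<lparr>carrier := K_univ n U\<rparr>"

lemma mem_K_univ:
  assumes "n \<ge> 2" "U \<subseteq> X n"
  shows "(\<a> i, \<a> j) \<in> K_univ n U \<longleftrightarrow>
    i < n \<and> j < n \<and> (i \<le> 1 \<or> j \<le> 1 \<or> (\<a> i, \<a> j) \<in> U \<or> (\<a> j, \<a> i) \<in> U)"
  using assms by (auto simp: K_univ_def DP_def X_def)

lemma K_univ_up:
  assumes n: "n \<ge> 2" and U: "up_set n U" and ij: "(\<a> i, \<a> j) \<in> K_univ n U"
    and le: "k \<le> i" "l \<le> j"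
  shows "(\<a> k, \<a> l) \<in> K_univ n U"
proof -
  have UX: "U \<subseteq> X n" using U by (simp add: up_set_def)
  have up: "(\<a> p', \<a> q') \<in> U"
    if "(\<a> p, \<a> q) \<in> U" "p' \<le> p" "q' \<le> q" "q' \<le> p'" "1 < q'" for p q p' q'
  proof -
    have "(\<a> p, \<a> q) \<in> X n" using that UX by blast
    then have "(\<a> p', \<a> q') \<in> X n" using that by (auto simp: X_def)
    moreover have "(\<a> p, \<a> q) \<le> (\<a> p', \<a> q')" using that by (simp add: less_eq_dp_def)
    ultimately show ?thesis using U that(1) unfolding up_set_def by blast
  qed
  have ge: "q \<le> p" if "(\<a> p, \<a> q) \<in> U" for p q
    using that UX by (auto simp: X_def)
  show ?thesis
  proof (cases "k \<le> 1 \<or> l \<le> 1")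
    case True
    then show ?thesis using ij le by (auto simp: mem_K_univ[OF n UX])
  next
    case False
    then have "(\<a> i, \<a> j) \<in> U \<or> (\<a> j, \<a> i) \<in> U"
      using ij le by (auto simp: mem_K_univ[OF n UX])
    then have "(\<a> k, \<a> l) \<in> U \<or> (\<a> l, \<a> k) \<in> U"
    proof
      assume h: "(\<a> i, \<a> j) \<in> U"
      show ?thesis
        using up[OF h, of k l] up[OF h, of l k] ge[OF h] le False by (cases "l \<le> k") auto
    next
      assume h: "(\<a> j, \<a> i) \<in> U"
      show ?thesis
        using up[OF h, of k l] up[OF h, of l k] ge[OF h] le False by (cases "l \<le> k") auto
    qed
    then show ?thesis using ij le by (auto simp: mem_K_univ[OF n UX])
  qed
qed

lemma K_DP_subalgebra:
  assumes n: "n \<ge> 2" and U: "up_set n U"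
  shows "rl_subalgebra (K_DP n U) (K (DP n))"
proof -
  have UX: "U \<subseteq> X n" using U by (simp add: up_set_def)
  note mem = mem_K_univ[OF n UX] and up = K_univ_up[OF n U]
  interpret bounded_comm_residuated_lattice "DP n"
    using n by (rule DP_residuated)
  have KA: "rl_algebra (K (DP n))"
    using algebra by (auto simp: rl_algebra_def K_def)
  have sub: "K_univ n U \<subseteq> carrier (DP n) \<times> carrier (DP n)"
    using n UX by (auto simp: K_univ_def DP_def X_def)
  have base: "(\<a> 0, \<a> 0) \<in> K_univ n U" "(\<a> (n - 1), \<a> 0) \<in> K_univ n U"
    using n by (auto simp: mem)
  have ops: "Join (K (DP n)) p q \<in> K_univ n U \<and> Meet (K (DP n)) p q \<in> K_univ n U \<and>
      p \<otimes>\<^bsub>K (DP n)\<^esub> q \<in> K_univ n U \<and> Imp (K (DP n)) p q \<in> K_univ n U"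
    if p: "p \<in> K_univ n U" and q: "q \<in> K_univ n U" for p q
  proof -
    obtain i j k l where pq: "p = (\<a> i, \<a> j)" "q = (\<a> k, \<a> l)"
      by (metis dp.exhaust prod.exhaust)
    have ij: "(\<a> i, \<a> j) \<in> K_univ n U" and kl: "(\<a> k, \<a> l) \<in> K_univ n U"
      using p q pq by auto
    have bd: "i < n" "j < n" "k < n" "l < n" using ij kl by (auto simp: mem)
    have sym: "(\<a> t, \<a> s) \<in> K_univ n U" if "(\<a> s, \<a> t) \<in> K_univ n U" for s t
      using that by (auto simp: mem)
    have mm: "min (\<a> s) (\<a> t) = \<a> (max s t)" "max (\<a> s) (\<a> t) = \<a> (min s t)" for s t
      by (auto simp: min_def max_def less_eq_dp_def)
    have j: "(\<a> (min i k), \<a> (max j l)) \<in> K_univ n U"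
      using up[OF ij, of "min i k" j] up[OF kl, of "min i k" l] by (auto simp: max_def)
    have m: "(\<a> (max i k), \<a> (min j l)) \<in> K_univ n U"
      using up[OF ij, of i "min j l"] up[OF kl, of k "min j l"] by (auto simp: max_def)
    have prod: "(\<a> i', \<a> j') \<otimes>\<^bsub>K (DP n)\<^esub> (\<a> k', \<a> l') \<in> K_univ n U"
      if h: "(\<a> i', \<a> j') \<in> K_univ n U" "(\<a> k', \<a> l') \<in> K_univ n U" for i' j' k' l'
    proof -
      have b: "i' < n" "j' < n" "k' < n" "l' < n" using h by (auto simp: mem)
      consider "i' \<noteq> 0" "k' \<noteq> 0" | "i' = 0" "k' = 0" | "i' = 0" "k' \<noteq> 0" | "i' \<noteq> 0" "k' = 0"
        by blast
      then show ?thesis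
      proof cases
        case 1 then show ?thesis
          using n b by (auto simp: K_def DP_def mem mm less_eq_dp_def)
      next
        case 2 then show ?thesis
          using n b by (auto simp: K_def DP_def mem mm less_eq_dp_def)
      next
        case 3 then show ?thesis
          using n b h by (cases "l' = 0") (auto simp: K_def DP_def mm less_eq_dp_def mem max_def)
      next
        case 4 then show ?thesis
          using n b h by (cases "j' = 0") (auto simp: K_def DP_def mm less_eq_dp_def mem max_def)
      qed
    qed
    have imp: "Imp (K (DP n)) p q = prod.swap (p \<otimes>\<^bsub>K (DP n)\<^esub> prod.swap q)"
      by (simp add: pq K_def)
    obtain s t where st: "p \<otimes>\<^bsub>K (DP n)\<^esub> prod.swap q = (\<a> s, \<a> t)"
      by (metis dp.exhaust prod.exhaust)
    have "Imp (K (DP n)) p q \<in> K_univ n U"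
      using prod[OF ij sym[OF kl]] st sym unfolding imp by (simp add: pq)
    moreover have "Join (K (DP n)) p q \<in> K_univ n U \<and> Meet (K (DP n)) p q \<in> K_univ n U"
      using j m by (simp add: pq K_def DP_def mm)
    ultimately show ?thesis using prod[OF ij kl] by (simp add: pq)
  qed
  have one: "\<one>\<^bsub>K (DP n)\<^esub> = (\<a> 0, \<a> 0)" "Zero (K (DP n)) = (\<a> (n - 1), \<a> 0)"
    by (simp_all add: K_def DP_def)
  have "rl_algebra (K_DP n U)"
    using ops base by (simp add: rl_algebra_def K_DP_def one)
  then show ?thesis
    using KA sub by (simp add: rl_subalgebra_def K_DP_def) (simp add: K_def)
qed

definition gens :: "nat \<Rightarrow> nat \<Rightarrow> (dp \<times> dp) set \<Rightarrow> (dp \<times> dp) set" where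
  "gens m n U =
     {(\<a> i, \<a> j) | i j. (\<a> i, \<a> j) \<in> U \<and> i < m - 1 \<and> j < m - 1} \<union>
     {(\<a> (n - 1), \<a> j) | j. (\<a> (m - 1), \<a> j) \<in> U \<and> j < m - 1} \<union>
     (if (\<a> (m - 1), \<a> (m - 1)) \<in> U then {(\<a> (n - 1), \<a> (n - 1))} else {})"

lemma gens_subset:
  assumes "m < n" "U \<subseteq> X m"
  shows "gens m n U \<subseteq> X n"
proof -
  have "j \<le> i \<and> 1 < j \<and> i < m" if "(\<a> i, \<a> j) \<in> U" for i j
    using that assms(2) by (auto simp: X_def)
  then show ?thesis
    using assms(1) unfolding gens_def X_def
    by (fastforce split: if_splits dest: less_trans)
qed

definition U_tilde :: "nat \<Rightarrow> nat \<Rightarrow> (dp \<times> dp) set \<Rightarrow> (dp \<times> dp) set" where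
  "U_tilde m n U = up_closure n (gens m n U)"

text \<open>On \<open>DP m\<close> with \<open>m \<ge> 4\<close>: $0 \mapsto 0$, $1 \mapsto 1$ and $a_k \mapsto a_k$
  for $1 \le k \le m - 2$.\<close>

definition dp_incl :: "nat \<Rightarrow> nat \<Rightarrow> dp \<Rightarrow> dp" where
  "dp_incl m n x = (if x = \<a> (m - 1) then \<a> (n - 1) else x)"

definition L2 :: "real rlat" where
  "L2 = \<lparr>carrier = {0, 1/2, 1},
     mult = (\<lambda>x y. max 0 (x + y - 1)),
     one = 1,
     Join = max, Meet = min,
     Imp = (\<lambda>x y. min 1 (1 - x + y)),
     Zero = 0\<rparr>"

definition oplus :: "real \<Rightarrow> real \<Rightarrow> real" where
  "oplus u v = min 1 (u + v)"

lemma L2_simps: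
  "carrier L2 = {0, 1/2, 1}" "x \<otimes>\<^bsub>L2\<^esub> y = max 0 (x + y - 1)" "\<one>\<^bsub>L2\<^esub> = 1"
  "Join L2 x y = max x y" "Meet L2 x y = min x y" "Imp L2 x y = min 1 (1 - x + y)"
  "Zero L2 = 0"
  by (simp_all add: L2_def)

lemma L2_residuated: "bounded_comm_residuated_lattice L2"
proof -
  have "rl_algebra L2"
    unfolding rl_algebra_def L2_simps by simp
  then show ?thesis
    by unfold_locales
      (unfold L2_simps, (simp add: rl_algebra_def L2_simps; fail | (elim insertE emptyE; simp))+)
qed

definition K02 :: "(real \<times> real) rlat" where
  "K02 = (K L2)\<lparr>carrier := {(u, v). u \<in> carrier L2 \<and> v \<in> carrier L2 \<and> oplus u v = 1}\<rparr>"

definition K12 :: "(real \<times> real) rlat" where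
  "K12 = (K L2)\<lparr>carrier := {(u, v). u \<in> carrier L2 \<and> v \<in> carrier L2 \<and> oplus u v \<ge> 1/2}\<rparr>"

lemma K_L2_subalgebra:
  assumes S: "S \<subseteq> carrier L2 \<times> carrier L2" and base: "(1, 1) \<in> S" "(0, 1) \<in> S"
    and ops: "\<And>a b c d. \<lbrakk>(a, b) \<in> S; (c, d) \<in> S\<rbrakk> \<Longrightarrow>
      (max a c, min b d) \<in> S \<and> (min a c, max b d) \<in> S \<and>
      (max 0 (a + c - 1), min (min 1 (1 - a + d)) (min 1 (1 - c + b))) \<in> S \<and>
      (min (min 1 (1 - a + c)) (min 1 (1 - d + b)), max 0 (a + d - 1)) \<in> S"
  shows "rl_subalgebra ((K L2)\<lparr>carrier := S\<rparr>) (K L2)"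
proof -
  interpret bounded_comm_residuated_lattice L2
    by (rule L2_residuated)
  have "rl_algebra (K L2)"
    using algebra by (auto simp: rl_algebra_def K_def)
  moreover have "rl_algebra ((K L2)\<lparr>carrier := S\<rparr>)"
    unfolding rl_algebra_def
  proof (intro conjI ballI)
    fix p q
    assume "p \<in> carrier ((K L2)\<lparr>carrier := S\<rparr>)" "q \<in> carrier ((K L2)\<lparr>carrier := S\<rparr>)"
    then obtain a b c d where pq: "p = (a, b)" "q = (c, d)" "(a, b) \<in> S" "(c, d) \<in> S"
      by (cases p; cases q) simp
    note o = ops[OF pq(3,4)]
    show "Join ((K L2)\<lparr>carrier := S\<rparr>) p q \<in> carrier ((K L2)\<lparr>carrier := S\<rparr>)"
      using o[THEN conjunct1] by (simp add: pq K_def L2_def)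
    show "Meet ((K L2)\<lparr>carrier := S\<rparr>) p q \<in> carrier ((K L2)\<lparr>carrier := S\<rparr>)"
      using o[THEN conjunct2, THEN conjunct1] by (simp add: pq K_def L2_def)
    show "p \<otimes>\<^bsub>(K L2)\<lparr>carrier := S\<rparr>\<^esub> q \<in> carrier ((K L2)\<lparr>carrier := S\<rparr>)"
      using o[THEN conjunct2, THEN conjunct2, THEN conjunct1] by (simp only: pq K_def L2_def rlat.simps monoid.simps partial_object.simps prod.case)
    show "Imp ((K L2)\<lparr>carrier := S\<rparr>) p q \<in> carrier ((K L2)\<lparr>carrier := S\<rparr>)"
      using o[THEN conjunct2, THEN conjunct2, THEN conjunct2] by (simp only: pq K_def L2_def rlat.simps monoid.simps partial_object.simps prod.case)
  qed (use base in \<open>simp_all add: K_def L2_def\<close>)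
  ultimately show ?thesis
    using S by (simp add: rl_subalgebra_def) (simp add: K_def)
qed

lemma K02_subalgebra: "rl_subalgebra K02 (K L2)"
proof -
  have S: "carrier K02 \<subseteq> carrier L2 \<times> carrier L2"
    by (auto simp: K02_def)
  have carr: "carrier K02 =
      {(0, 1), (1, 0), (1/2, 1/2), (1/2, 1), (1, 1/2), (1, 1)}"
  proof (intro subset_antisym subsetI)
    fix p
    assume "p \<in> carrier K02"
    then obtain u v where p: "p = (u, v)" and u: "u = 0 \<or> u = 1/2 \<or> u = 1"
      and v: "v = 0 \<or> v = 1/2 \<or> v = 1" and "oplus u v = 1"
      unfolding K02_def L2_def by (cases p) simp
    then have "\<not> (u = 0 \<and> v = 0)" "\<not> (u = 0 \<and> v = 1/2)" "\<not> (u = 1/2 \<and> v = 0)"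
      by (auto simp: oplus_def)
    with u v show "p \<in> {(0, 1), (1, 0), (1/2, 1/2), (1/2, 1), (1, 1/2), (1, 1)}"
      unfolding p by blast
  next
    fix p :: "real \<times> real"
    assume "p \<in> {(0, 1), (1, 0), (1/2, 1/2), (1/2, 1), (1, 1/2), (1, 1)}"
    then show "p \<in> carrier K02"
      unfolding insert_iff empty_iff
      by (elim disjE FalseE; hypsubst; simp add: K02_def L2_def oplus_def)
  qed
  have base: "(1, 1) \<in> carrier K02" "(0, 1) \<in> carrier K02"
    unfolding carr by simp_all
  have ops: "(max a c, min b d) \<in> carrier K02 \<and> (min a c, max b d) \<in> carrier K02 \<and>
     (max 0 (a + c - 1), min (min 1 (1 - a + d)) (min 1 (1 - c + b))) \<in> carrier K02 \<and>
     (min (min 1 (1 - a + c)) (min 1 (1 - d + b)), max 0 (a + d - 1)) \<in> carrier K02"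
    if "(a, b) \<in> carrier K02" "(c, d) \<in> carrier K02" for a b c d
    using that unfolding carr insert_iff empty_iff prod.inject by (elim disjE conjE FalseE; hypsubst; simp)
  have "rl_subalgebra ((K L2)\<lparr>carrier := carrier K02\<rparr>) (K L2)"
    using S base ops by (rule K_L2_subalgebra)
  then show ?thesis by (simp add: K02_def)
qed

lemma K12_subalgebra: "rl_subalgebra K12 (K L2)"
proof -
  have S: "carrier K12 \<subseteq> carrier L2 \<times> carrier L2"
    by (auto simp: K12_def)
  have carr: "carrier K12 =
      {(0, 1/2), (1/2, 0), (0, 1), (1, 0), (1/2, 1/2), (1/2, 1), (1, 1/2), (1, 1)}"
  proof (intro subset_antisym subsetI)
    fix p
    assume "p \<in> carrier K12"
    then obtain u v where p: "p = (u, v)" and u: "u = 0 \<or> u = 1/2 \<or> u = 1"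
      and v: "v = 0 \<or> v = 1/2 \<or> v = 1" and "oplus u v \<ge> 1/2"
      unfolding K12_def L2_def by (cases p) simp
    then have "\<not> (u = 0 \<and> v = 0)"
      by (auto simp: oplus_def)
    with u v show "p \<in> {(0, 1/2), (1/2, 0), (0, 1), (1, 0), (1/2, 1/2), (1/2, 1), (1, 1/2), (1, 1)}"
      unfolding p by blast
  next
    fix p :: "real \<times> real"
    assume "p \<in> {(0, 1/2), (1/2, 0), (0, 1), (1, 0), (1/2, 1/2), (1/2, 1), (1, 1/2), (1, 1)}"
    then show "p \<in> carrier K12"
      unfolding insert_iff empty_iff
      by (elim disjE FalseE; hypsubst; simp add: K12_def L2_def oplus_def)
  qed
  have base: "(1, 1) \<in> carrier K12" "(0, 1) \<in> carrier K12"
    unfolding carr by simp_all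
  have ops: "(max a c, min b d) \<in> carrier K12 \<and> (min a c, max b d) \<in> carrier K12 \<and>
     (max 0 (a + c - 1), min (min 1 (1 - a + d)) (min 1 (1 - c + b))) \<in> carrier K12 \<and>
     (min (min 1 (1 - a + c)) (min 1 (1 - d + b)), max 0 (a + d - 1)) \<in> carrier K12"
    if "(a, b) \<in> carrier K12" "(c, d) \<in> carrier K12" for a b c d
    using that unfolding carr insert_iff empty_iff prod.inject by (elim disjE conjE FalseE; hypsubst; simp)
  have "rl_subalgebra ((K L2)\<lparr>carrier := carrier K12\<rparr>) (K L2)"
    using S base ops by (rule K_L2_subalgebra)
  then show ?thesis by (simp add: K12_def)
qed

end

theory Submission
  imports Defs
begin

text \<open>The construction \<open>K\<close> is functorial on embeddings, so it suffices to embed the base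
  algebras (\<open>L2\<close>, respectively \<open>DP m\<close>, into \<open>DP n\<close>) and to check that the induced map on pairs
  sends the one subuniverse into the other. For \<open>K12\<close> this holds because its only missing pair
  is \<open>(0, 0)\<close>, and \<open>1/2\<close> goes to $a_1$. In the second part, \<open>gens\<close> is exactly the image
  of \<open>U\<close>.\<close>

text \<open>Neither closure of the carriers nor injectivity is part of the notion, so it passes to
  arbitrary subsets of the carriers.\<close>

definition rl_hom :: "('a \<Rightarrow> 'b) \<Rightarrow> 'a rlat \<Rightarrow> 'b rlat \<Rightarrow> bool" where
  "rl_hom h A B \<longleftrightarrow>
     h ` carrier A \<subseteq> carrier B \<and> h \<one>\<^bsub>A\<^esub> = \<one>\<^bsub>B\<^esub> \<and> h (Zero A) = Zero B \<and>
     (\<forall>x\<in>carrier A. \<forall>y\<in>carrier A.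
        h (Join A x y) = Join B (h x) (h y) \<and> h (Meet A x y) = Meet B (h x) (h y) \<and>
        h (x \<otimes>\<^bsub>A\<^esub> y) = h x \<otimes>\<^bsub>B\<^esub> h y \<and> h (Imp A x y) = Imp B (h x) (h y))"

text \<open>The image of \<open>h\<close> is closed because \<open>A\<close> is closed and
  \<open>h\<close> commutes with the operations.\<close>

lemma rl_embeddingI:
  assumes A: "rl_algebra A" and B: "rl_algebra B"
    and hom: "rl_hom h A B" and inj: "inj_on h (carrier A)"
  shows "rl_embedding h A B"
proof -
  let ?C = "B\<lparr>carrier := h ` carrier A\<rparr>"
  have sub: "h ` carrier A \<subseteq> carrier B" using hom by (simp add: rl_hom_def)
  have one: "\<one>\<^bsub>B\<^esub> \<in> h ` carrier A" "Zero B \<in> h ` carrier A"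
    using A hom unfolding rl_algebra_def rl_hom_def by (metis imageI)+
  have ops: "Join B (h x) (h y) \<in> h ` carrier A" "Meet B (h x) (h y) \<in> h ` carrier A"
      "h x \<otimes>\<^bsub>B\<^esub> h y \<in> h ` carrier A" "Imp B (h x) (h y) \<in> h ` carrier A"
    if "x \<in> carrier A" "y \<in> carrier A" for x y
    using A hom that unfolding rl_algebra_def rl_hom_def by (metis imageI)+
  have C: "rl_algebra ?C"
    using one ops by (auto simp: rl_algebra_def)
  have "rl_subalgebra ?C B"
    using B C sub by (simp add: rl_subalgebra_def)
  moreover have "rl_iso h A ?C"
    using A C hom inj by (simp add: rl_iso_def rl_hom_def bij_betw_def)
  ultimately show ?thesis by (simp add: rl_embedding_def)
qed

lemma rl_embedding_imp_iso_to_subalgebra: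
  "rl_embedding h A B \<Longrightarrow> iso_to_subalgebra A B"
  by (auto simp: rl_embedding_def iso_to_subalgebra_def Let_def)

text \<open>The operations of \<open>K\<close> are terms in those of the base; closure of
  \<open>A\<close> lets \<open>h\<close> pass through nested terms such as a \<open>Meet\<close> of
  two \<open>Imp\<close>s.\<close>

lemma rl_hom_K:
  assumes A: "rl_algebra A" and hom: "rl_hom h A B"
  shows "rl_hom (map_prod h h) (K A) (K B)"
  using assms unfolding rl_hom_def rl_algebra_def by (auto simp: K_def)

lemma rl_hom_restrict:
  assumes "rl_hom h A B" "S \<subseteq> carrier A" "h ` S \<subseteq> T"
  shows "rl_hom h (A\<lparr>carrier := S\<rparr>) (B\<lparr>carrier := T\<rparr>)"
  using assms by (auto simp: rl_hom_def subset_iff)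

lemma rl_embedding_K_restrict:
  assumes A: "rl_algebra A" and hom: "rl_hom h A B" and inj: "inj_on h (carrier A)"
    and S: "rl_subalgebra ((K A)\<lparr>carrier := S\<rparr>) (K A)"
    and T: "rl_subalgebra ((K B)\<lparr>carrier := T\<rparr>) (K B)"
    and ST: "map_prod h h ` S \<subseteq> T"
  shows "rl_embedding (map_prod h h) ((K A)\<lparr>carrier := S\<rparr>) ((K B)\<lparr>carrier := T\<rparr>)"
proof (rule rl_embeddingI)
  have SA: "S \<subseteq> carrier A \<times> carrier A"
    using S by (simp add: rl_subalgebra_def K_def)
  then show "rl_hom (map_prod h h) ((K A)\<lparr>carrier := S\<rparr>) ((K B)\<lparr>carrier := T\<rparr>)"
    using ST by (intro rl_hom_restrict rl_hom_K[OF A hom]) (simp_all add: K_def)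
  show "inj_on (map_prod h h) (carrier ((K A)\<lparr>carrier := S\<rparr>))"
    using inj_on_subset[OF map_prod_inj_on[OF inj inj] SA] by simp
qed (use S T in \<open>simp_all add: rl_subalgebra_def\<close>)

text \<open>For \<open>n \<ge> 3\<close> this is the inclusion of the chain $DP_3$, in its guise as
  \<open>L2\<close>, into \<open>DP n\<close>.\<close>

definition L2_to_DP :: "nat \<Rightarrow> real \<Rightarrow> dp" where
  "L2_to_DP n x = (if x = 0 then \<a> (n - 1) else if x = 1 then \<a> 0 else \<a> 1)"

lemma rl_hom_L2_to_DP:
  assumes "n \<ge> 3"
  shows "rl_hom (L2_to_DP n) L2 (DP n)"
  using assms unfolding rl_hom_def L2_simps
  by (auto simp: DP_def L2_to_DP_def less_eq_dp_def min_def max_def)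

lemma inj_L2_to_DP:
  assumes "n \<ge> 3"
  shows "inj_on (L2_to_DP n) (carrier L2)"
  using assms by (auto simp: inj_on_def L2_simps L2_to_DP_def)

text \<open>Both share the operations of \<open>K L2\<close>, so only the inclusion of carriers
  remains.\<close>

lemma K02_subalgebra_K12: "rl_subalgebra K02 K12"
  using K02_subalgebra K12_subalgebra
  by (auto simp: rl_subalgebra_def K02_def K12_def)

lemma K12_iso_to_subalgebra:
  assumes n: "n \<ge> 3"
  shows "iso_to_subalgebra K12 (K_DP n {})"
proof -
  have "(L2_to_DP n u, L2_to_DP n v) \<in> K_univ n {}"
    if "u \<in> carrier L2" "v \<in> carrier L2" "oplus u v \<ge> 1/2" for u v
    using that n by (auto simp: K_univ_def DP_def L2_simps L2_to_DP_def oplus_def)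
  then have "map_prod (L2_to_DP n) (L2_to_DP n) ` carrier K12 \<subseteq> K_univ n {}"
    by (auto simp: K12_def)
  moreover have "rl_subalgebra (K_DP n {}) (K (DP n))"
    using n by (intro K_DP_subalgebra) (auto simp: up_set_def)
  ultimately have "rl_embedding (map_prod (L2_to_DP n) (L2_to_DP n)) K12 (K_DP n {})"
    \<comment> \<open>Restricting \<open>K L2\<close> to \<open>carrier K12\<close> gives back
      \<open>K12\<close> itself.\<close>
    using rl_embedding_K_restrict[OF
        bounded_comm_residuated_lattice.algebra[OF L2_residuated]
        rl_hom_L2_to_DP[OF n] inj_L2_to_DP[OF n], of "carrier K12" "K_univ n {}"] K12_subalgebra
    by (simp add: K12_def K_DP_def)
  then show ?thesis by (rule rl_embedding_imp_iso_to_subalgebra)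
qed

text \<open>Only the bottom moves, and it moves weakly down, so order is kept. Products of non-units
  are bottom, and $a_1$, the value of \<open>Imp\<close> at $1 > x > y$, stays fixed since
  \<open>3 \<le> m\<close> separates it from the bottom.\<close>

lemma rl_hom_dp_incl:
  assumes "3 \<le> m" "m \<le> n"
  shows "rl_hom (dp_incl m n) (DP m) (DP n)"
  using assms
  by (auto simp: rl_hom_def DP_def dp_incl_def less_eq_dp_def min_def max_def)

text \<open>The new bottom has index \<open>n - 1 \<ge> m - 1\<close>, so it differs from every
  fixed $a_k$ with \<open>k < m - 1\<close>.\<close>

lemma inj_dp_incl:
  assumes "m \<le> n"
  shows "inj_on (dp_incl m n) (carrier (DP m))"
  using assms by (auto simp: inj_on_def DP_def dp_incl_def split: if_splits)

lemma dp_incl_gens: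
  assumes U: "U \<subseteq> X m" and p: "(x, y) \<in> U"
  shows "(dp_incl m n x, dp_incl m n y) \<in> gens m n U"
proof -
  obtain i j where xy: "x = \<a> i" "y = \<a> j" "i < m" "j \<le> i"
    using U p by (auto simp: X_def)
  \<comment> \<open>Since \<open>j \<le> i\<close>, a bottom second component forces a bottom first
    one; the cases left are the three clauses of \<open>gens\<close>.\<close>
  then consider "i < m - 1" "j < m - 1" | "i = m - 1" "j < m - 1" | "i = m - 1" "j = m - 1"
    by linarith
  then show ?thesis
    using p by cases (auto simp: xy gens_def dp_incl_def)
qed

text \<open>A component $1$ or $a_1$ is fixed, which settles the pairs outside \<open>U\<close>;
  pairs of \<open>U\<close> become generators of \<open>U_tilde m n U\<close>.\<close>

lemma dp_incl_K_univ:
  assumes "3 \<le> m" "m < n" and U: "U \<subseteq> X m"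
  shows "map_prod (dp_incl m n) (dp_incl m n) ` K_univ m U \<subseteq> K_univ n (U_tilde m n U)"
proof -
  have "(dp_incl m n x, dp_incl m n y) \<in> U_tilde m n U" if "(x, y) \<in> U" for x y
    using dp_incl_gens[OF U that] up_closure_least(2)[OF gens_subset] assms
    unfolding U_tilde_def by blast
  moreover have "dp_incl m n x \<in> carrier (DP n)" if "x \<in> carrier (DP m)" for x
    using that assms by (auto simp: DP_def dp_incl_def)
  moreover have "dp_incl m n (\<a> 0) = \<a> 0" "dp_incl m n (\<a> 1) = \<a> 1"
    using assms by (auto simp: dp_incl_def)
  ultimately show ?thesis
    unfolding K_univ_def by fastforce
qed

theorem theorem3p8:
  shows "(\<forall>n\<ge>4. rl_subalgebra K02 K12 \<and> iso_to_subalgebra K12 (K_DP n {})) \<and>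
   (\<forall>m n U. 4 \<le> m \<and> m < n \<and> up_set m U \<longrightarrow>
      iso_to_subalgebra (K_DP m U) (K_DP n (U_tilde m n U)) \<and>
      rl_embedding (dp_incl m n) (DP m) (DP n) \<and>
      rl_embedding (map_prod (dp_incl m n) (dp_incl m n))
        (K_DP m U) (K_DP n (U_tilde m n U)))"
proof (intro conjI allI impI)
  show "rl_subalgebra K02 K12" by (rule K02_subalgebra_K12)
  show "iso_to_subalgebra K12 (K_DP n {})" if "n \<ge> 4" for n
    using that by (intro K12_iso_to_subalgebra) simp
  fix m n U
  assume "4 \<le> m \<and> m < n \<and> up_set m U"
  then have m: "3 \<le> m" "2 \<le> m" and mn: "m < n" "m \<le> n" "2 \<le> n" and U: "up_set m U"
    by auto
  then have UX: "U \<subseteq> X m" by (simp add: up_set_def)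
  note hom = rl_hom_dp_incl[OF m(1) mn(2)] and inj = inj_dp_incl[OF mn(2)]
  note algs = bounded_comm_residuated_lattice.algebra[OF DP_residuated[OF m(2)]]
    bounded_comm_residuated_lattice.algebra[OF DP_residuated[OF mn(3)]]
  show "rl_embedding (dp_incl m n) (DP m) (DP n)"
    using algs hom inj by (rule rl_embeddingI)
  have "up_set n (U_tilde m n U)"
    unfolding U_tilde_def by (rule up_closure_least(1)[OF gens_subset[OF mn(1) UX]])
  then show emb: "rl_embedding (map_prod (dp_incl m n) (dp_incl m n))
      (K_DP m U) (K_DP n (U_tilde m n U))"
    using rl_embedding_K_restrict[OF algs(1) hom inj] dp_incl_K_univ[OF m(1) mn(1) UX]
      K_DP_subalgebra[OF m(2) U] K_DP_subalgebra[OF mn(3)]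
    by (simp add: K_DP_def)
  show "iso_to_subalgebra (K_DP m U) (K_DP n (U_tilde m n U))"
    using emb by (rule rl_embedding_imp_iso_to_subalgebra)
qed

end
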